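(* Let $m\ge 3$ be an integer. For each $a=(a_1,\dots,a_{m-1})\in\mathbb{C}^{m-1}$ there exists $M>0$ such that the eigenvalues $\lambda_n$ of $H$ satisfy $|\lambda_n|<|\lambda_{n+1}|$ if $n\ge M$.
   Context: For $a=(a_1,\dots,a_{m-1})\in\mathbb{C}^{m-1}$ put $P_{m-1}(z)=a_1z^{m-1}+a_2z^{m-2}+\cdots+a_{m-1}z$. The operator $H$ is $$Hu(z)=-u''(z)-\left[(iz)^m+P_{m-1}(iz)\right]u(z),\qquad z\in\mathbb{C}.$$ A number $\lambda\in\mathbb{C}$ is an eigenvalue of $H$ if there is a nonconstant function $u$ with $Hu=\lambda u$ such that $u(z)\to0$ exponentially as $z\to\infty$ along the two rays $\arg z=-\frac{\pi}{2}\pm\frac{2\pi}{m+2}$. It is known that the eigenvalues form an infinite discrete set in $\mathbb{C}$, accumulating at infinity, and that each has geometric multiplicity one. The eigenvalues $\lambda_n$ are indexed as in their asymptotic expansion: there are $e_\ell(a)\in\mathbb{C}$, $1\le\ell\le\frac m2+1$, such that $$\lambda_n=\lambda_{0,n}+\sum_{\ell=1}^{\lfloor \frac m2+1\rfloor} e_\ell(a)\,\lambda_{0,n}^{1-\frac{\ell}{m}}+o\left(\lambda_{0,n}^{\frac12-\frac1m}\right)\quad\text{as } n\to+\infty,$$ where $\lambda_{0,n}=\left(\frac{(n+\frac12)\pi}{K_m\sin(2\pi/m)}\right)^{\frac{2m}{m+2}}$, $K_m=\int_0^\infty\left(\sqrt{1+t^m}-\sqrt{t^m}\right)dt>0$,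 and $\lfloor x\rfloor$ is the largest integer $\le x$. *)

theory Defs
  imports "HOL-Analysis.Analysis" "HOL-Library.Landau_Symbols"
begin

text \<open>A vector \<open>a = (a\<^sub>1, \<dots>, a\<^bsub>m-1\<^esub>)\<close> is a function on \<open>nat\<close>; only its values on
  \<open>{1..m-1}\<close> are ever used.\<close>

definition lower_poly :: "nat \<Rightarrow> (nat \<Rightarrow> complex) \<Rightarrow> complex \<Rightarrow> complex" where
  "lower_poly m a z = (\<Sum>k = 1..m - 1. a k * z ^ (m - k))"

definition H_op :: "nat \<Rightarrow> (nat \<Rightarrow> complex) \<Rightarrow> (complex \<Rightarrow> complex) \<Rightarrow> complex \<Rightarrow> complex" where
  "H_op m a u z = - deriv (deriv u) z - ((\<i> * z) ^ m + lower_poly m a (\<i> * z)) * u z"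

definition exp_decay_along_ray :: "(complex \<Rightarrow> complex) \<Rightarrow> real \<Rightarrow> bool" where
  "exp_decay_along_ray u \<theta> \<longleftrightarrow>
     (\<exists>c>0. (\<lambda>r::real. norm (u (of_real r * cis \<theta>))) \<in> O[at_top](\<lambda>r. exp (- c * r)))"

text \<open>The equation \<open>Hu = \<lambda>u\<close> on the whole plane presupposes that \<open>u\<close> is complex
  differentiable; since \<open>deriv\<close> is total, this has to be required explicitly.\<close>

definition is_eigenvalue :: "nat \<Rightarrow> (nat \<Rightarrow> complex) \<Rightarrow> complex \<Rightarrow> bool" where
  "is_eigenvalue m a \<mu> \<longleftrightarrow>
     (\<exists>u. u holomorphic_on UNIV \<and> \<not> u constant_on UNIV \<and>
          (\<forall>z. H_op m a u z = \<mu> * u z) \<and>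
          exp_decay_along_ray u (- pi / 2 + 2 * pi / (real m + 2)) \<and>
          exp_decay_along_ray u (- pi / 2 - 2 * pi / (real m + 2)))"

definition K_const :: "nat \<Rightarrow> real" where
  "K_const m = integral {0..} (\<lambda>t::real. sqrt (1 + t ^ m) - sqrt (t ^ m))"

definition lambda0 :: "nat \<Rightarrow> nat \<Rightarrow> real" where
  "lambda0 m n =
     ((real n + 1 / 2) * pi / (K_const m * sin (2 * pi / real m)))
       powr (2 * real m / (real m + 2))"

definition has_eigenvalue_expansion :: "nat \<Rightarrow> (nat \<Rightarrow> complex) \<Rightarrow> bool" where
  "has_eigenvalue_expansion m lam \<longleftrightarrow>
     (\<exists>e :: nat \<Rightarrow> complex.
        (\<lambda>n. lam n - (of_real (lambda0 m n)
               + (\<Sum>l = 1..nat \<lfloor>real m / 2 + 1\<rfloor>.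
                    e l * of_real (lambda0 m n powr (1 - real l / real m)))))
          \<in> o(\<lambda>n. of_real (lambda0 m n powr (1 / 2 - 1 / real m))))"

text \<open>An enumeration of the eigenvalues with the indices prescribed by the expansion.
  It need not be injective: a value may be repeated (as when eigenvalues are listed with
  algebraic multiplicity).\<close>

definition eigenvalue_indexing :: "nat \<Rightarrow> (nat \<Rightarrow> complex) \<Rightarrow> (nat \<Rightarrow> complex) \<Rightarrow> bool" where
  "eigenvalue_indexing m a lam \<longleftrightarrow>
     range lam = {\<mu>. is_eigenvalue m a \<mu>} \<and> has_eigenvalue_expansion m lam"

end

theory Submission
  imports Defs "HOL-Real_Asymp.Real_Asymp"
begin

text \<open>Consecutive leading terms \<open>\<lambda>\<^bsub>0,n\<^esub>\<close> differ by about a positive constant times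
  \<open>g n = \<lambda>\<^bsub>0,n\<^esub> powr (1/2 - 1/m)\<close>, which is exactly the scale of the error term, while the
  differences of the lower-order powers are \<open>o(g n)\<close>. Hence \<open>(\<lambda>\<^bsub>n+1\<^esub> - \<lambda>\<^sub>n) / g n\<close> tends to
  a positive real number and \<open>\<lambda>\<^sub>n / \<lambda>\<^bsub>0,n\<^esub>\<close> tends to 1, so the increment eventually has
  positive real inner product with \<open>\<lambda>\<^sub>n\<close> and the modulus grows.\<close>

text \<open>The hypothesis says |z|^2 < Re (w * cnj z), and the right side is at most |w| |z|. It
  also forces \<open>z\<close> to be nonzero, so one factor |z| cancels.\<close>

lemma norm_less_if_increment_positive:
  fixes w z :: complex
  assumes "0 < Re ((w - z) * cnj z)"
  shows "norm z < norm w"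
proof -
  have "z \<noteq> 0"
    using assms by auto
  have "norm z * norm z < Re (w * cnj z)"
    using assms by (simp add: algebra_simps complex_norm_square[symmetric] cmod_def power2_eq_square)
  also have "\<dots> \<le> norm w * norm z"
    using complex_Re_le_cmod[of "w * cnj z"] by (simp add: norm_mult)
  finally show ?thesis
    using \<open>z \<noteq> 0\<close> by simp
qed

text \<open>The increment and the value are normalised by different positive scales. The product of
  the first quotient with the conjugate of the second tends to \<open>d > 0\<close>, and removing
  the positive factor \<open>g n * L n\<close> keeps the sign.\<close>

lemma eventually_norm_less_Suc:
  fixes lam :: "nat \<Rightarrow> complex" and L g :: "nat \<Rightarrow> real"
  assumes inc: "(\<lambda>n. (lam (Suc n) - lam n) / of_real (g n)) \<longlonglongrightarrow> of_real d"
    and ratio: "(\<lambda>n. lam n / of_real (L n)) \<longlonglongrightarrow> 1"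
    and "0 < d" "\<And>n. 0 < L n" "\<And>n. 0 < g n"
  shows "\<forall>\<^sub>F n in sequentially. norm (lam n) < norm (lam (Suc n))"
proof -
  have "(\<lambda>n. Re ((lam (Suc n) - lam n) / of_real (g n) * cnj (lam n / of_real (L n))))
          \<longlonglongrightarrow> Re (of_real d * cnj 1)"
    by (intro tendsto_intros inc ratio)
  then have "\<forall>\<^sub>F n in sequentially.
      0 < Re ((lam (Suc n) - lam n) / of_real (g n) * cnj (lam n / of_real (L n)))"
    by (rule order_tendstoD(1)) (use \<open>0 < d\<close> in simp)
  then show ?thesis
  proof eventually_elim
    case (elim n)
    have "(lam (Suc n) - lam n) / of_real (g n) * cnj (lam n / of_real (L n))
        = (lam (Suc n) - lam n) * cnj (lam n) / of_real (g n * L n)"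
      by simp
    with elim have "0 < Re ((lam (Suc n) - lam n) * cnj (lam n)) / (g n * L n)"
      by (metis Re_divide_of_real)
    then have "0 < Re ((lam (Suc n) - lam n) * cnj (lam n))"
      using assms(4,5)[of n] by (simp add: zero_less_divide_iff mult_less_0_iff not_less_iff_gr_or_eq)
    then show ?case
      by (rule norm_less_if_increment_positive)
  qed
qed

text \<open>A unit step changes (C x)^p by about its derivative p C (C x)^(p-1), here at x = n +
  1/2.\<close>

lemma powr_half_shift_diff_tendsto:
  fixes C p :: real
  assumes "0 < C"
  shows "(\<lambda>n::nat. ((C * (real (Suc n) + 1/2)) powr p - (C * (real n + 1/2)) powr p)
           / (C * (real n + 1/2)) powr (p - 1)) \<longlonglongrightarrow> p * C"
  using assms by (real_asymp simp: powr_diff)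

lemma powr_half_shift_ratio_tendsto_0:
  fixes C p q :: real
  assumes "0 < C" "p < q"
  shows "(\<lambda>n::nat. (C * (real n + 1/2)) powr p / (C * (real n + 1/2)) powr q) \<longlonglongrightarrow> 0"
  using assms by real_asymp

text \<open>The increment has order at most \<open>p - 1\<close> by the derivative estimate, so a
  denominator of the larger order \<open>q - 1\<close> dominates it.\<close>

lemma powr_half_shift_diff_tendsto_0:
  fixes C p q :: real
  assumes "0 < C" "p < q"
  shows "(\<lambda>n::nat. ((C * (real (Suc n) + 1/2)) powr p - (C * (real n + 1/2)) powr p)
           / (C * (real n + 1/2)) powr (q - 1)) \<longlonglongrightarrow> 0"
proof -
  have "(\<lambda>n::nat. ((C * (real (Suc n) + 1/2)) powr p - (C * (real n + 1/2)) powr p)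
           / (C * (real n + 1/2)) powr (p - 1)
           * ((C * (real n + 1/2)) powr (p - 1) / (C * (real n + 1/2)) powr (q - 1))) \<longlonglongrightarrow> p * C * 0"
    using assms
    by (intro tendsto_mult powr_half_shift_diff_tendsto powr_half_shift_ratio_tendsto_0) auto
  moreover have "(C * (real n + 1/2)) powr (p - 1) \<noteq> 0" for n
    using \<open>0 < C\<close> by simp
  ultimately show ?thesis
    by simp
qed

lemma powr_half_shift_Suc_ratio_tendsto_1:
  fixes C p :: real
  assumes "0 < C"
  shows "(\<lambda>n::nat. (C * (real (Suc n) + 1/2)) powr p / (C * (real n + 1/2)) powr p) \<longlonglongrightarrow> 1"
  using assms by real_asymp

text \<open>Rationalised form of the integrand of \<open>K_const\<close>: it gives both the decay at
  infinity and a lower bound near 0.\<close>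

lemma sqrt_diff_eq_inverse:
  fixes s :: real
  assumes "0 \<le> s"
  shows "sqrt (1 + s) - sqrt s = 1 / (sqrt (1 + s) + sqrt s)"
proof -
  have "(sqrt (1 + s) - sqrt s) * (sqrt (1 + s) + sqrt s) = 1"
    using assms by (simp add: algebra_simps)
  moreover have "sqrt (1 + s) + sqrt s > 0"
    using assms by (simp add: add_pos_nonneg)
  ultimately show ?thesis
    by (simp add: field_simps)
qed

text \<open>For t >= 1 the rationalised denominator is at least t^(m/2) >= t^(3/2), so the tail is
  dominated by an integrable power. This ensures that \<open>integral\<close> in
  \<open>K_const\<close> is not the default value 0.\<close>

lemma sqrt_diff_power_integrable:
  fixes m :: nat
  assumes "3 \<le> m"
  shows "(\<lambda>t::real. sqrt (1 + t ^ m) - sqrt (t ^ m)) integrable_on {0..}"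
proof -
  let ?f = "\<lambda>t::real. sqrt (1 + t ^ m) - sqrt (t ^ m)"
  have "((\<lambda>t::real. t powr (- 3/2)) has_integral - (1 powr (- 3/2 + 1)) / (- 3/2 + 1)) {1..}"
    by (rule has_integral_powr_to_inf) auto
  then have dom: "(\<lambda>t::real. t powr (- 3/2)) integrable_on {1..}"
    by blast
  have bound: "norm (?f t) \<le> t powr (- 3/2)" if "t \<in> {1..}" for t
  proof -
    have t: "1 \<le> t"
      using that by simp
    have "t powr (3/2) = (t powr 3) powr (1/2)"
      by (simp add: powr_powr)
    also have "\<dots> = sqrt (t ^ 3)"
      using t by (simp add: powr_half_sqrt)
    also have "\<dots> \<le> sqrt (t ^ m)"
      using t assms by (simp add: power_increasing)
    also have "\<dots> \<le> sqrt (1 + t ^ m) + sqrt (t ^ m)"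
      using t by simp
    finally have "1 / (sqrt (1 + t ^ m) + sqrt (t ^ m)) \<le> 1 / t powr (3/2)"
      using t by (intro divide_left_mono) (auto intro!: mult_pos_pos add_pos_pos)
    then show ?thesis
      using t sqrt_diff_eq_inverse[of "t ^ m"] by (simp add: powr_minus_divide)
  qed
  have "?f integrable_on {1..}"
  proof (rule measurable_bounded_by_integrable_imp_integrable[OF _ dom bound])
    show "?f \<in> borel_measurable (lebesgue_on {1..})"
      by (intro continuous_imp_measurable_on_sets_lebesgue continuous_intros) auto
  qed auto
  moreover have "?f integrable_on {0..1}"
    by (intro integrable_continuous_interval continuous_intros)
  moreover have "{0..1} \<inter> {1..} = {1::real}"
    by auto
  ultimately have "?f integrable_on {0..1} \<union> {1..}"
    by (intro integrable_Un) simp_all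
  moreover have "{0..1} \<union> {1..} = {0::real..}"
    by auto
  ultimately show ?thesis
    by simp
qed

lemma K_const_pos:
  assumes "3 \<le> m"
  shows "0 < K_const m"
proof -
  let ?f = "\<lambda>t::real. sqrt (1 + t ^ m) - sqrt (t ^ m)"
  \<comment> \<open>The denominator is at most 2 + 1 on the unit interval.\<close>
  have "1 / 3 \<le> ?f t" if "t \<in> {0..1}" for t
  proof -
    have t: "0 \<le> t ^ m" "t ^ m \<le> 1"
      using that by (auto simp: power_le_one)
    have "sqrt (1 + t ^ m) \<le> 2" "sqrt (t ^ m) \<le> 1"
      using t by (auto intro: real_le_lsqrt)
    moreover have "0 < sqrt (1 + t ^ m) + sqrt (t ^ m)"
      using t by (simp add: add_pos_nonneg)
    ultimately have "1 / 3 \<le> 1 / (sqrt (1 + t ^ m) + sqrt (t ^ m))"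
      by (intro divide_left_mono) (linarith, simp_all)
    then show ?thesis
      using sqrt_diff_eq_inverse[OF t(1)] by simp
  qed
  then have "integral {0..1} (\<lambda>t::real. 1 / 3 :: real) \<le> integral {0..1} ?f"
    by (intro integral_le integrable_continuous_interval continuous_intros) auto
  \<comment> \<open>The integrand is nonnegative, so enlarging the domain does not decrease the
    integral.\<close>
  also have "\<dots> \<le> integral {0..} ?f"
    by (intro integral_subset_le sqrt_diff_power_integrable assms
        integrable_continuous_interval continuous_intros) auto
  finally show ?thesis
    by (simp add: K_const_def)
qed

theorem theorem3:
  fixes m :: nat and a :: "nat \<Rightarrow> complex" and lam :: "nat \<Rightarrow> complex"
  assumes "m \<ge> 3"
    and "eigenvalue_indexing m a lam"
  shows "\<exists>M::nat. M > 0 \<and> (\<forall>n\<ge>M. norm (lam n) < norm (lam (Suc n)))"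
proof -
  \<comment> \<open>With these constants \<open>lambda0 m n\<close> is a power of
    \<open>X n\<close>, which is affine in \<open>n\<close>; every scale below becomes such a
    power.\<close>
  define C where "C = pi / (K_const m * sin (2 * pi / real m))"
  define p where "p = 2 * real m / (real m + 2)"
  define X where "X n = C * (real n + 1/2)" for n
  define L where "L n = X n powr p" for n
  define g where "g n = X n powr (p - 1)" for n
  define E where "E = {1..nat \<lfloor>real m / 2 + 1\<rfloor>}"
  have "0 < sin (2 * pi / real m)"
    using \<open>m \<ge> 3\<close> by (intro sin_gt_zero) (auto simp: field_simps)
  then have C: "0 < C"
    using K_const_pos[OF \<open>m \<ge> 3\<close>] by (simp add: C_def)
  have p: "1 < p"
    using \<open>m \<ge> 3\<close> by (simp add: p_def field_simps)
  have X: "0 < X n" for n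
    using C by (simp add: X_def)
  have lambda0: "lambda0 m n = L n" for n
    by (simp add: lambda0_def L_def X_def C_def p_def mult.commute)
  have L_powr: "L n powr s = X n powr (p * s)" for n s
    by (simp add: L_def powr_powr)
  \<comment> \<open>Both sides equal (m-2)/(m+2): the exponent of the error term is that of the
    derivative of x^p.\<close>
  have "p * (1/2 - 1 / real m) = p - 1"
    using \<open>m \<ge> 3\<close> by (simp add: p_def divide_simps)
  then have g: "L n powr (1/2 - 1 / real m) = g n" for n
    by (simp add: L_powr g_def)
  have g_pos: "0 < g n" and L_pos: "0 < L n" for n
    using X[of n] by (auto simp: g_def L_def)
  obtain e where e: "(\<lambda>n. lam n - (of_real (L n)
      + (\<Sum>l\<in>E. e l * of_real (L n powr (1 - real l / real m))))) \<in> o(\<lambda>n. of_real (g n))"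
    using assms(2) unfolding eigenvalue_indexing_def has_eigenvalue_expansion_def lambda0 g E_def
    by blast
  define q where "q l = p * (1 - real l / real m)" for l
  \<comment> \<open>Indices in \<open>E\<close> start at 1, which makes the inequality
    strict.\<close>
  have q: "q l < p" if "l \<in> E" for l
    using that p \<open>m \<ge> 3\<close> by (simp add: q_def E_def)
  define S where "S n = (\<Sum>l\<in>E. e l * of_real (X n powr q l))" for n
  define err where "err n = lam n - (of_real (L n) + S n)" for n
  have lam: "lam n = of_real (L n) + S n + err n" for n
    by (simp add: err_def)
  have "err \<in> o(\<lambda>n. of_real (g n))"
    using e by (simp add: err_def[abs_def] S_def q_def L_powr)
  then have err: "(\<lambda>n. err n / of_real (g n)) \<longlonglongrightarrow> 0"
    by (rule smalloD_tendsto)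

  have "(\<lambda>n. (X (Suc n) powr q l - X n powr q l) / g n) \<longlonglongrightarrow> 0" if "l \<in> E" for l
    unfolding X_def g_def using powr_half_shift_diff_tendsto_0[OF C q[OF that]] .
  then have "(\<lambda>n. \<Sum>l\<in>E. e l * of_real ((X (Suc n) powr q l - X n powr q l) / g n))
      \<longlonglongrightarrow> (\<Sum>l\<in>E. e l * of_real 0)"
    by (intro tendsto_intros)
  then have S_inc: "(\<lambda>n. (S (Suc n) - S n) / of_real (g n)) \<longlonglongrightarrow> 0"
    by (simp add: S_def sum_subtractf sum_divide_distrib right_diff_distrib diff_divide_distrib)
  have "(\<lambda>n. X n powr q l / L n) \<longlonglongrightarrow> 0" if "l \<in> E" for l
    unfolding X_def L_def using powr_half_shift_ratio_tendsto_0[OF C q[OF that]] .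
  then have "(\<lambda>n. \<Sum>l\<in>E. e l * of_real (X n powr q l / L n)) \<longlonglongrightarrow> (\<Sum>l\<in>E. e l * of_real 0)"
    by (intro tendsto_intros)
  then have S_ratio: "(\<lambda>n. S n / of_real (L n)) \<longlonglongrightarrow> 0"
    by (simp add: S_def sum_divide_distrib)

  have g_Suc: "(\<lambda>n. g (Suc n) / g n) \<longlonglongrightarrow> 1"
    unfolding X_def g_def by (rule powr_half_shift_Suc_ratio_tendsto_1[OF C])
  \<comment> \<open>The bound on \<open>err (Suc n)\<close> is relative to \<open>g (Suc n)\<close>;
    the factor tending to 1 converts it to the scale \<open>g n\<close>.\<close>
  have "(\<lambda>n. err (Suc n) / of_real (g (Suc n)) * of_real (g (Suc n) / g n) - err n / of_real (g n))
      \<longlonglongrightarrow> 0 * of_real 1 - 0"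
    by (intro tendsto_intros err g_Suc LIMSEQ_Suc[OF err])
  then have err_inc: "(\<lambda>n. (err (Suc n) - err n) / of_real (g n)) \<longlonglongrightarrow> 0"
    using g_pos by (simp add: diff_divide_distrib less_imp_neq[symmetric])
  have g_ratio: "(\<lambda>n. g n / L n) \<longlonglongrightarrow> 0"
    unfolding X_def g_def L_def by (rule powr_half_shift_ratio_tendsto_0[OF C]) simp
  have "(\<lambda>n. err n / of_real (g n) * of_real (g n / L n)) \<longlonglongrightarrow> 0 * of_real 0"
    by (intro tendsto_intros err g_ratio)
  then have err_ratio: "(\<lambda>n. err n / of_real (L n)) \<longlonglongrightarrow> 0"
    using g_pos by (simp add: less_imp_neq[symmetric])

  have L_inc: "(\<lambda>n. (L (Suc n) - L n) / g n) \<longlonglongrightarrow> p * C"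
    unfolding X_def g_def L_def by (rule powr_half_shift_diff_tendsto[OF C])
  \<comment> \<open>Only the leading term survives in the limit, and \<open>p * C\<close> serves as
    the positive \<open>d\<close>.\<close>
  have "(\<lambda>n. of_real ((L (Suc n) - L n) / g n) + (S (Suc n) - S n) / of_real (g n)
      + (err (Suc n) - err n) / of_real (g n)) \<longlonglongrightarrow> of_real (p * C) + 0 + (0 :: complex)"
    by (intro tendsto_intros L_inc S_inc err_inc)
  then have inc: "(\<lambda>n. (lam (Suc n) - lam n) / of_real (g n)) \<longlonglongrightarrow> of_real (p * C)"
    by (simp add: lam add_divide_distrib diff_divide_distrib algebra_simps)
  have "(\<lambda>n. 1 + S n / of_real (L n) + err n / of_real (L n)) \<longlonglongrightarrow> 1 + 0 + (0 :: complex)"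
    by (intro tendsto_intros S_ratio err_ratio)
  then have ratio: "(\<lambda>n. lam n / of_real (L n)) \<longlonglongrightarrow> 1"
    using L_pos by (simp add: lam add_divide_distrib less_imp_neq[symmetric])
  have "\<forall>\<^sub>F n in sequentially. norm (lam n) < norm (lam (Suc n))"
    using p C by (intro eventually_norm_less_Suc[OF inc ratio _ L_pos g_pos]) simp
  then obtain M where "\<forall>n\<ge>M. norm (lam n) < norm (lam (Suc n))"
    by (auto simp: eventually_sequentially)
  then show ?thesis
    \<comment> \<open>The successor secures a positive threshold even if \<open>M\<close> is
      0.\<close>
    by (intro exI[of _ "Suc M"]) auto
qed

end
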